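(* Let $p,d\geq 1$, let $t_1<t_2<\cdots<t_p$ be real numbers and let $\epsilon=(\epsilon_{ij})\in\{+1,-1\}^{p\times d}$. Define $C^+_{ij}=(j-1)t_i$ if $\epsilon_{ij}=+1$ and $C^+_{ij}=-\infty$ otherwise, and $C^-_{ij}=(j-1)t_i$ if $\epsilon_{ij}=-1$ and $C^-_{ij}=-\infty$ otherwise. Let \[ \mathcal{K}(\epsilon)=\Big\{x\in(\mathbb{R}\cup\{-\infty\})^d:\ \max_{1\leq j\leq d}(C^-_{ij}+x_j)\leq\max_{1\leq j\leq d}(C^+_{ij}+x_j)\ \text{for all }1\leq i\leq p\Big\} \] (the tropical polar of the signed cyclic polyhedral cone with sign pattern $\epsilon$). Then the extreme rays of $\mathcal{K}(\epsilon)$ are in one-to-one correspondence with the tropically allowed lattice paths for the sign pattern $\epsilon$.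
   Context: Tropical notions: $\mathbb{R}_{\max}=\mathbb{R}\cup\{-\infty\}$ with $\oplus=\max$ and $\otimes=+$; $u\oplus v$ is the entrywise max of vectors and $\lambda u=(\lambda+u_j)_j$. For a tropical cone $\mathcal{C}$ (closed under $(u,v)\mapsto\lambda u\oplus\mu v$), a non-($-\infty$) vector $u\in\mathcal{C}$ is an extreme generator if $u=v\oplus w$ with $v,w\in\mathcal{C}$ implies $u=v$ or $u=w$; an extreme ray is the set of tropical scalar multiples $\{\lambda u\}$ of an extreme generator. Lattice paths: a lattice path in the $p\times d$ grid is specified by an integer $k\geq 0$ and indices $1\leq i_1<\cdots<i_k\leq p$, $1\leq j_1<\cdots<j_{k+1}\leq d$; it is the sequence of positions $(1,j_1),\ldots,(i_1,j_1),\ldots,(i_1,j_2),\ldots,(i_2,j_2),\ldots,(i_k,j_{k+1}),\ldots,(p,j_{k+1})$, moving alternately down a column and right along a row. Its horizontal segments are, for $1\leq r\leq k$, row $i_r$ from column $j_r$ (leftmost position) to column $j_{r+1}$ (rightmost position). Its vertical segments are: the initial one (column $j_1$, rows $1$ to $i_1$), the intermediate ones (column $j_r$, rows $i_{r-1}$ to $i_r$, $2\leq r\leq k$), and the final one (column $j_{k+1}$, rows $i_k$ to $p$); when $k=0$ there is a single vertical segment, column $j_1$, rows $1$ to $p$. The path is allowed for $\epsilon$ if: (C1) if $k\geq1$, $\epsilon_{ij_1}=+1$ for all $1\leq i<i_1$; (C2) if $k\geq1$, $\epsilon_{ij_{k+1}}=+1$ for all $i_k<i\leq p$, and if $k=0$,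 $\epsilon_{ij_1}=+1$ for all $1\leq i\leq p$; (C3) for $2\leq r\leq k$, $\epsilon_{ij_r}=+1$ for all $i_{r-1}<i<i_r$; (C4) for each $1\leq r\leq k$, $(\epsilon_{i_rj_r},\epsilon_{i_rj_{r+1}})$ is $(+1,-1)$ or $(-1,+1)$. It is tropically allowed if moreover (C5) whenever $(\epsilon_{i_rj_r},\epsilon_{i_rj_{r+1}})=(-1,+1)$ for some $r$, also $(\epsilon_{i_sj_s},\epsilon_{i_sj_{s+1}})=(-1,+1)$ for all $r\leq s\leq k$. *)

theory Defs
  imports "HOL-Library.Extended_Real"
begin

text \<open>
  The tropical semiring R with minus infinity is the part of \<^typ>\<open>ereal\<close> that omits \<open>\<infinity>\<close>; there
  the addition of \<^typ>\<open>ereal\<close> makes minus infinity absorbing. A vector with entries indexed by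
  \<open>1, \<dots>, d\<close> is a function on \<^typ>\<open>nat\<close> that is minus infinity outside \<open>{1..d}\<close>, so that equality of
  functions is equality of vectors, and the tropical operations can be taken pointwise.
\<close>

definition trop_vectors :: "nat \<Rightarrow> (nat \<Rightarrow> ereal) set" where
  "trop_vectors d = {x. (\<forall>j. x j \<noteq> \<infinity>) \<and> (\<forall>j. j \<notin> {1..d} \<longrightarrow> x j = -\<infinity>)}"

definition trop_add :: "('a \<Rightarrow> ereal) \<Rightarrow> ('a \<Rightarrow> ereal) \<Rightarrow> 'a \<Rightarrow> ereal" where
  "trop_add u v = (\<lambda>j. max (u j) (v j))"

definition trop_scale :: "ereal \<Rightarrow> ('a \<Rightarrow> ereal) \<Rightarrow> 'a \<Rightarrow> ereal" where
  "trop_scale l u = (\<lambda>j. l + u j)"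

definition trop_cone :: "('a \<Rightarrow> ereal) set \<Rightarrow> bool" where
  "trop_cone C \<longleftrightarrow> (\<forall>u\<in>C. \<forall>v\<in>C. \<forall>l m. l \<noteq> \<infinity> \<longrightarrow> m \<noteq> \<infinity> \<longrightarrow>
     trop_add (trop_scale l u) (trop_scale m v) \<in> C)"

definition extreme_generator :: "('a \<Rightarrow> ereal) set \<Rightarrow> ('a \<Rightarrow> ereal) \<Rightarrow> bool" where
  "extreme_generator C u \<longleftrightarrow> u \<in> C \<and> u \<noteq> (\<lambda>_. -\<infinity>) \<and>
     (\<forall>v\<in>C. \<forall>w\<in>C. u = trop_add v w \<longrightarrow> u = v \<or> u = w)"

definition trop_ray :: "('a \<Rightarrow> ereal) \<Rightarrow> ('a \<Rightarrow> ereal) set" where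
  "trop_ray u = {trop_scale l u | l. l \<noteq> \<infinity>}"

definition extreme_rays :: "('a \<Rightarrow> ereal) set \<Rightarrow> ('a \<Rightarrow> ereal) set set" where
  "extreme_rays C = {trop_ray u | u. extreme_generator C u}"

definition C_plus :: "(nat \<Rightarrow> real) \<Rightarrow> (nat \<Rightarrow> nat \<Rightarrow> int) \<Rightarrow> nat \<Rightarrow> nat \<Rightarrow> ereal" where
  "C_plus t eps i j = (if eps i j = 1 then ereal ((real j - 1) * t i) else -\<infinity>)"

definition C_minus :: "(nat \<Rightarrow> real) \<Rightarrow> (nat \<Rightarrow> nat \<Rightarrow> int) \<Rightarrow> nat \<Rightarrow> nat \<Rightarrow> ereal" where
  "C_minus t eps i j = (if eps i j = -1 then ereal ((real j - 1) * t i) else -\<infinity>)"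

definition signed_cyclic_polar ::
  "nat \<Rightarrow> nat \<Rightarrow> (nat \<Rightarrow> real) \<Rightarrow> (nat \<Rightarrow> nat \<Rightarrow> int) \<Rightarrow> (nat \<Rightarrow> ereal) set" where
  "signed_cyclic_polar p d t eps = {x \<in> trop_vectors d. \<forall>i\<in>{1..p}.
     (MAX j\<in>{1..d}. C_minus t eps i j + x j) \<le> (MAX j\<in>{1..d}. C_plus t eps i j + x j)}"

lemma trop_cone_signed_cyclic_polar:
  assumes "d \<ge> 1"
  shows "trop_cone (signed_cyclic_polar p d t eps)"
  unfolding trop_cone_def
proof (intro ballI allI impI)
  fix u v and l m :: ereal
  assume u: "u \<in> signed_cyclic_polar p d t eps" and v: "v \<in> signed_cyclic_polar p d t eps"
    and l: "l \<noteq> \<infinity>" and m: "m \<noteq> \<infinity>"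
  let ?w = "trop_add (trop_scale l u) (trop_scale m v)"
  have uv: "u j \<noteq> \<infinity>" "v j \<noteq> \<infinity>" "j \<notin> {1..d} \<Longrightarrow> u j = -\<infinity>" "j \<notin> {1..d} \<Longrightarrow> v j = -\<infinity>" for j
    using u v by (auto simp: signed_cyclic_polar_def trop_vectors_def)
  have w: "?w \<in> trop_vectors d"
    unfolding trop_vectors_def trop_add_def trop_scale_def mem_Collect_eq
  proof (intro conjI allI impI)
    show "max (l + u j) (m + v j) \<noteq> \<infinity>" for j
      using uv(1,2)[of j] l m by (simp add: max_def)
    show "max (l + u j) (m + v j) = -\<infinity>" if "j \<notin> {1..d}" for j
      using uv(3,4)[OF that] l m by (cases l; cases m) simp_all
  qed
  have fin: "finite {1..d}" "{1..d} \<noteq> {}" using assms by auto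
  have combine: "c + ?w j = max (l + (c + u j)) (m + (c + v j))" for c j
    using max_of_mono[of "(+) c" "l + u j" "m + v j"]
    by (simp add: trop_add_def trop_scale_def mono_def add_left_mono add.left_commute)
  have step: "C_minus t eps i j + ?w j \<le> (MAX j\<in>{1..d}. C_plus t eps i j + ?w j)"
    if i: "i \<in> {1..p}" and j: "j \<in> {1..d}" for i j
  proof -
    have half: "k + (C_minus t eps i j + x j) \<le> (MAX j\<in>{1..d}. C_plus t eps i j + ?w j)"
      if x: "x \<in> signed_cyclic_polar p d t eps"
        and le: "\<And>c j. k + (c + x j) \<le> c + ?w j" for x k
    proof -
      have "C_minus t eps i j + x j \<le> (MAX j\<in>{1..d}. C_minus t eps i j + x j)"
        using j by (intro Max_ge) auto
      also have "\<dots> \<le> (MAX j\<in>{1..d}. C_plus t eps i j + x j)"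
        using x i by (auto simp: signed_cyclic_polar_def)
      finally have "C_minus t eps i j + x j \<le> (MAX j\<in>{1..d}. C_plus t eps i j + x j)" .
      moreover have "(MAX j\<in>{1..d}. C_plus t eps i j + x j) \<in> (\<lambda>j. C_plus t eps i j + x j) ` {1..d}"
        using fin by (intro Max_in) auto
      then obtain j' where j': "j' \<in> {1..d}"
        "(MAX j\<in>{1..d}. C_plus t eps i j + x j) = C_plus t eps i j' + x j'" by blast
      ultimately have "k + (C_minus t eps i j + x j) \<le> k + (C_plus t eps i j' + x j')"
        by (simp add: add_left_mono)
      also have "\<dots> \<le> C_plus t eps i j' + ?w j'" by (rule le)
      also have "\<dots> \<le> (MAX j\<in>{1..d}. C_plus t eps i j + ?w j)"
        using j' by (intro Max_ge) auto
      finally show ?thesis .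
    qed
    show ?thesis
      unfolding combine[of "C_minus t eps i j"]
      by (rule max.boundedI[OF half[OF u] half[OF v]]) (simp_all only: combine max.cobounded1 max.cobounded2)
  qed
  show "?w \<in> signed_cyclic_polar p d t eps"
    unfolding signed_cyclic_polar_def mem_Collect_eq
  proof (intro conjI ballI w)
    fix i assume "i \<in> {1..p}"
    from step[OF this] show "(MAX j\<in>{1..d}. C_minus t eps i j + ?w j)
        \<le> (MAX j\<in>{1..d}. C_plus t eps i j + ?w j)"
      using fin by (intro Max.boundedI) blast+
  qed
qed

text \<open>
  The rows \<open>i\<^sub>1 < \<dots> < i\<^sub>k\<close> and columns \<open>j\<^sub>1 < \<dots> < j\<^sub>k\<^sub>+\<^sub>1\<close> specifying a path are given as lists;
  list positions start at 0, so \<open>i\<^sub>r = rs ! (r - 1)\<close> and \<open>j\<^sub>r = cs ! (r - 1)\<close>.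
\<close>

definition path_data :: "nat \<Rightarrow> nat \<Rightarrow> nat list \<Rightarrow> nat list \<Rightarrow> bool" where
  "path_data p d rs cs \<longleftrightarrow> length cs = length rs + 1 \<and>
     sorted_wrt (<) rs \<and> set rs \<subseteq> {1..p} \<and> sorted_wrt (<) cs \<and> set cs \<subseteq> {1..d}"

text \<open>
  The positions, as pairs (row, column), from row \<open>a\<close> and column \<open>hd cs\<close> on. Each segment is listed
  without its last position, which is the first position of the next segment.
\<close>

fun path_from :: "nat \<Rightarrow> nat \<Rightarrow> nat list \<Rightarrow> nat list \<Rightarrow> (nat \<times> nat) list" where
  "path_from p a [] [c] = map (\<lambda>i. (i, c)) [a..<p + 1]"
| "path_from p a (r # rs) (c # c' # cs) =
     map (\<lambda>i. (i, c)) [a..<r] @ map (\<lambda>j. (r, j)) [c..<c'] @ path_from p r rs (c' # cs)"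
| "path_from p a _ _ = []"

definition lattice_path :: "nat \<Rightarrow> nat list \<Rightarrow> nat list \<Rightarrow> (nat \<times> nat) list" where
  "lattice_path p rs cs = path_from p 1 rs cs"

definition allowed :: "nat \<Rightarrow> (nat \<Rightarrow> nat \<Rightarrow> int) \<Rightarrow> nat list \<Rightarrow> nat list \<Rightarrow> bool" where
  "allowed p eps rs cs \<longleftrightarrow> (let k = length rs in
     (k \<ge> 1 \<longrightarrow> (\<forall>i. 1 \<le> i \<and> i < rs ! 0 \<longrightarrow> eps i (cs ! 0) = 1)) \<and>
     (k \<ge> 1 \<longrightarrow> (\<forall>i. rs ! (k - 1) < i \<and> i \<le> p \<longrightarrow> eps i (cs ! k) = 1)) \<and>
     (k = 0 \<longrightarrow> (\<forall>i. 1 \<le> i \<and> i \<le> p \<longrightarrow> eps i (cs ! 0) = 1)) \<and>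
     (\<forall>r. 1 \<le> r \<and> r < k \<longrightarrow> (\<forall>i. rs ! (r - 1) < i \<and> i < rs ! r \<longrightarrow> eps i (cs ! r) = 1)) \<and>
     (\<forall>r<k. (eps (rs ! r) (cs ! r), eps (rs ! r) (cs ! (r + 1))) \<in> {(1, -1), (-1, 1)}))"

definition tropically_allowed :: "nat \<Rightarrow> (nat \<Rightarrow> nat \<Rightarrow> int) \<Rightarrow> nat list \<Rightarrow> nat list \<Rightarrow> bool" where
  "tropically_allowed p eps rs cs \<longleftrightarrow> allowed p eps rs cs \<and>
     (\<forall>r<length rs. (eps (rs ! r) (cs ! r), eps (rs ! r) (cs ! (r + 1))) = (-1, 1) \<longrightarrow>
       (\<forall>s. r \<le> s \<and> s < length rs \<longrightarrow>
         (eps (rs ! s) (cs ! s), eps (rs ! s) (cs ! (s + 1))) = (-1, 1)))"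

definition tropically_allowed_paths ::
  "nat \<Rightarrow> nat \<Rightarrow> (nat \<Rightarrow> nat \<Rightarrow> int) \<Rightarrow> (nat \<times> nat) list set" where
  "tropically_allowed_paths p d eps =
     {lattice_path p rs cs | rs cs. path_data p d rs cs \<and> tropically_allowed p eps rs cs}"

text \<open>
  A path determines its data, so being (tropically) allowed is a property of the sequence of positions.
\<close>

lemma path_from_bounds:
  assumes "(i, j) \<in> set (path_from p a rs cs)" "length cs = length rs + 1"
    "sorted_wrt (<) rs" "\<forall>r\<in>set rs. a \<le> r" "sorted_wrt (<) cs"
  shows "a \<le> i \<and> hd cs \<le> j \<and> ((\<forall>r\<in>set rs. a < r) \<longrightarrow> i = a \<longrightarrow> j = hd cs)"
  using assms
proof (induction p a rs cs rule: path_from.induct)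
  case (2 p a r rs c c' cs)
  have "r \<le> i \<and> c' \<le> j" if "(i, j) \<in> set (path_from p r rs (c' # cs))"
    using 2(1)[OF that] 2(3-6) by (simp add: less_imp_le)
  moreover have "c < c'" "a \<le> r" using 2(5,6) by auto
  ultimately show ?case using 2(2) by auto
qed auto

lemma path_from_start:
  assumes "length cs = length rs + 1" "sorted_wrt (<) rs" "set rs \<subseteq> {a..p}" "sorted_wrt (<) cs" "a \<le> p"
  shows "path_from p a rs cs \<noteq> [] \<and> hd (path_from p a rs cs) = (a, hd cs)"
  using assms
proof (induction p a rs cs rule: path_from.induct)
  case (2 p a r rs c c' cs)
  then have "set rs \<subseteq> {r..p}" by (auto simp: less_imp_le)
  then have "path_from p r rs (c' # cs) \<noteq> [] \<and> hd (path_from p r rs (c' # cs)) = (r, c')"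
    using 2 by simp
  with 2(2-) show ?case by (cases "a = r") (simp_all add: hd_append hd_map)
qed (auto simp: hd_map simp del: upt_Suc)

lemma path_from_first_row:
  assumes "length (c # c' # cs) = length (r # rs) + 1" "sorted_wrt (<) (r # rs)"
    "set (r # rs) \<subseteq> {a..p}" "sorted_wrt (<) (c # c' # cs)"
  shows "(r, c') \<in> set (path_from p a (r # rs) (c # c' # cs))"
    "(i, j) \<in> set (path_from p a (r # rs) (c # c' # cs)) \<Longrightarrow> (c < j \<longrightarrow> r \<le> i) \<and> (i = r \<longrightarrow> j \<le> c')"
proof -
  have "set rs \<subseteq> {r..p}" using assms by (auto simp: less_imp_le)
  then have "path_from p r rs (c' # cs) \<noteq> [] \<and> hd (path_from p r rs (c' # cs)) = (r, c')"
    using path_from_start[of "c' # cs" rs r p] assms by simp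
  then show "(r, c') \<in> set (path_from p a (r # rs) (c # c' # cs))"
    by (metis Un_iff hd_in_set path_from.simps(2) set_append)
  have "r \<le> i \<and> (i = r \<longrightarrow> j = c')" if "(i, j) \<in> set (path_from p r rs (c' # cs))"
    using path_from_bounds[OF that] assms by (simp add: less_imp_le)
  then show "(i, j) \<in> set (path_from p a (r # rs) (c # c' # cs)) \<Longrightarrow> (c < j \<longrightarrow> r \<le> i) \<and> (i = r \<longrightarrow> j \<le> c')"
    by auto
qed

lemma path_from_inject:
  assumes "path_from p a rs cs = path_from p a rs' cs'"
    "length cs = length rs + 1" "sorted_wrt (<) rs" "set rs \<subseteq> {a..p}" "sorted_wrt (<) cs"
    "length cs' = length rs' + 1" "sorted_wrt (<) rs'" "set rs' \<subseteq> {a..p}" "sorted_wrt (<) cs'"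
    "a \<le> p"
  shows "rs = rs' \<and> cs = cs'"
  using assms
proof (induction rs arbitrary: a cs rs' cs')
  case Nil
  obtain c where c: "cs = [c]" using Nil.prems(2) by (cases cs) auto
  have hd: "hd cs' = c"
    using path_from_start[OF Nil.prems(2-5,10)] path_from_start[OF Nil.prems(6-10)] Nil.prems(1) c
    by (metis list.sel(1) prod.inject)
  have "rs' = []"
  proof (cases rs')
    case (Cons r' rs'')
    obtain c2 ds where cs': "cs' = c # c2 # ds"
      using Nil.prems(6) Cons hd by (cases cs'; cases "tl cs'") auto
    have "(r', c2) \<in> set (path_from p a [] cs)"
      unfolding Nil.prems(1) Cons cs'
      by (rule path_from_first_row(1)) (use Nil.prems Cons cs' in simp_all)
    then show ?thesis using Nil.prems(9) c cs' by auto
  qed simp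
  then show ?case using Nil.prems(6) c hd by (cases cs') auto
next
  case (Cons r rs)
  obtain c c2 ds where cs: "cs = c # c2 # ds"
    using Cons.prems(2) by (cases cs; cases "tl cs") auto
  have hd: "hd cs' = c"
    using path_from_start[OF Cons.prems(2-5,10)] path_from_start[OF Cons.prems(6-10)] Cons.prems(1) cs
    by (metis list.sel(1) prod.inject)
  note first = path_from_first_row[OF Cons.prems(2-5)[unfolded cs]]
  have "rs' \<noteq> []"
  proof
    assume "rs' = []"
    moreover from this have "cs' = [c]" using Cons.prems(6) hd by (cases cs') auto
    ultimately have "(r, c2) \<in> set (path_from p a [] [c])"
      using first(1) Cons.prems(1) cs \<open>rs' = []\<close> by metis
    then show False using Cons.prems(5) cs by auto
  qed
  then obtain r' rs'' where rs': "rs' = r' # rs''" by (cases rs') auto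
  obtain c2' ds' where cs': "cs' = c # c2' # ds'"
    using Cons.prems(6) rs' hd by (cases cs'; cases "tl cs'") auto
  note first' = path_from_first_row[OF Cons.prems(6-9)[unfolded rs' cs']]
  note eq = Cons.prems(1)[unfolded cs rs' cs']
  have lt: "c < c2" "c < c2'" using Cons.prems(5,9) cs cs' by auto
  have swap: "(c < c2' \<longrightarrow> r \<le> r') \<and> (r' = r \<longrightarrow> c2' \<le> c2)"
      "(c < c2 \<longrightarrow> r' \<le> r) \<and> (r = r' \<longrightarrow> c2 \<le> c2')"
    using first(2)[unfolded eq, OF first'(1)] first'(2)[folded eq, OF first(1)] by blast+
  then have r: "r' = r" and c2: "c2' = c2" using lt by auto
  have "path_from p r rs (c2 # ds) = path_from p r rs'' (c2 # ds')"
    using eq by (simp add: r c2)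
  moreover have "set rs \<subseteq> {r..p}" "set rs'' \<subseteq> {r..p}" "r \<le> p"
    using Cons.prems(3,4,7,8) by (auto simp: rs' r less_imp_le)
  ultimately have "rs = rs'' \<and> c2 # ds = c2 # ds'"
    using Cons.prems(2,3,5,6,7,9) by (intro Cons.IH[of r]) (simp_all add: cs cs' rs' r c2)
  then show ?case using cs cs' rs' r c2 by simp
qed

lemma lattice_path_inject:
  assumes "p \<ge> 1" "path_data p d rs cs" "path_data p d rs' cs'"
    "lattice_path p rs cs = lattice_path p rs' cs'"
  shows "rs = rs' \<and> cs = cs'"
  using assms path_from_inject[of p 1 rs cs rs' cs']
  by (auto simp: path_data_def lattice_path_def)

end

theory Submission
  imports Defs
begin

text \<open>
  A vector lies in the polar iff in each row \<open>i\<close> the set of columns attaining the maximum of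
  \<open>(j - 1) * t i + x j\<close> contains a column of sign \<open>1\<close>. These sets move to the right as \<open>i\<close> grows.
  A column can be lowered without leaving the polar unless it is, in some row with a tie, the only
  maximizing column of sign \<open>1\<close>; if two columns of the support could be lowered, the vector would
  not be extreme. On the other hand there are fewer rows with ties than columns in the support.
  Hence the support of an extreme vector is a chain of columns, consecutive ones tied in one row,
  with opposite signs: this chain is a lattice path. The signs of the ties single out all columns but
  one, which forces the pattern of a tropically allowed path.
\<close>

section \<open>Supports, row values and maximizing columns\<close>

definition trop_supp :: "('a \<Rightarrow> ereal) \<Rightarrow> 'a set" where
  "trop_supp x = {j. x j \<noteq> -\<infinity>}"

text \<open>\<open>real_of_ereal\<close> sends minus infinity to 0, so the value is meaningful only
  on the support; hence \<open>row_argmax\<close> ranges over the support alone.\<close>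

definition row_val :: "(nat \<Rightarrow> real) \<Rightarrow> (nat \<Rightarrow> ereal) \<Rightarrow> nat \<Rightarrow> nat \<Rightarrow> real" where
  "row_val t x i j = (real j - 1) * t i + real_of_ereal (x j)"

definition row_argmax :: "(nat \<Rightarrow> real) \<Rightarrow> (nat \<Rightarrow> ereal) \<Rightarrow> nat \<Rightarrow> nat set" where
  "row_argmax t x i = {j \<in> trop_supp x. \<forall>l\<in>trop_supp x. row_val t x i l \<le> row_val t x i j}"

lemma row_argmax_supp: "row_argmax t x i \<subseteq> trop_supp x"
  by (auto simp: row_argmax_def)

lemma row_argmaxD: "j \<in> row_argmax t x i \<Longrightarrow> l \<in> trop_supp x \<Longrightarrow> row_val t x i l \<le> row_val t x i j"
  by (auto simp: row_argmax_def)

lemma trop_vectors_supp: "x \<in> trop_vectors d \<Longrightarrow> trop_supp x \<subseteq> {1..d}"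
  by (force simp: trop_vectors_def trop_supp_def)

lemma finite_trop_supp: "x \<in> trop_vectors d \<Longrightarrow> finite (trop_supp x)"
  using finite_subset[OF trop_vectors_supp] by blast

lemma trop_vectors_entry:
  "x \<in> trop_vectors d \<Longrightarrow> j \<in> trop_supp x \<Longrightarrow> x j = ereal (real_of_ereal (x j))"
  by (cases "x j") (auto simp: trop_vectors_def trop_supp_def)

lemma row_val_entry:
  "x \<in> trop_vectors d \<Longrightarrow> j \<in> trop_supp x \<Longrightarrow>
    ereal ((real j - 1) * t i) + x j = ereal (row_val t x i j)"
  by (subst trop_vectors_entry) (auto simp: row_val_def)

lemma ex_row_argmax:
  assumes "finite (trop_supp x)" "trop_supp x \<noteq> {}"
  shows "\<exists>j. j \<in> row_argmax t x i"
proof -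
  have "Max (row_val t x i ` trop_supp x) \<in> row_val t x i ` trop_supp x"
    using assms by (intro Max_in) auto
  then obtain j where "j \<in> trop_supp x" "Max (row_val t x i ` trop_supp x) = row_val t x i j" by auto
  moreover have "row_val t x i l \<le> Max (row_val t x i ` trop_supp x)" if "l \<in> trop_supp x" for l
    using assms that by (intro Max_ge) auto
  ultimately show ?thesis by (auto simp: row_argmax_def)
qed

lemma trop_supp_nonempty: "trop_supp x \<noteq> {} \<longleftrightarrow> x \<noteq> (\<lambda>_. -\<infinity>)"
  by (auto simp: trop_supp_def fun_eq_iff)

lemma trop_ray_scale: "trop_ray (trop_scale (ereal l) x) = trop_ray x"
proof -
  have 1: "trop_ray (trop_scale (ereal l) x) \<subseteq> trop_ray x" for l and x :: "'a \<Rightarrow> ereal"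
  proof
    fix y assume "y \<in> trop_ray (trop_scale (ereal l) x)"
    then obtain m where m: "m \<noteq> \<infinity>" "y = trop_scale m (trop_scale (ereal l) x)"
      by (auto simp: trop_ray_def)
    then have "y = trop_scale (m + ereal l) x" by (simp add: trop_scale_def add.assoc)
    moreover have "m + ereal l \<noteq> \<infinity>" using m by simp
    ultimately show "y \<in> trop_ray x" by (auto simp: trop_ray_def)
  qed
  \<comment> \<open>Scaling by the real number \<open>l\<close> is undone by \<open>- l\<close>,
    which turns the inclusion into an equality.\<close>
  have "trop_scale (ereal (- l)) (trop_scale (ereal l) x) = x"
    by (simp add: trop_scale_def add.assoc[symmetric] fun_eq_iff zero_ereal_def[symmetric])
  then show ?thesis using 1[of l x] 1[of "- l" "trop_scale (ereal l) x"] by simp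
qed

text \<open>Serves to derive (C4) from the fact that a tie between two columns has exactly one
  positive column.\<close>

lemma unique_sign:
  fixes f :: "'a \<Rightarrow> int"
  assumes "a \<noteq> b" "f a \<in> {1, -1}" "f b \<in> {1, -1}" "{l \<in> {a, b}. f l = 1} = {j}"
  shows "(f a, f b) \<in> {(1, -1), (-1, 1)}"
proof -
  have mem: "l \<in> {a, b} \<and> f l = 1 \<longleftrightarrow> l = j" for l using assms(4) by (simp add: set_eq_iff)
  have "\<not> (f a = 1 \<and> f b = 1)" using mem[of a] mem[of b] assms(1) by auto
  moreover have "f a = 1 \<or> f b = 1" using mem[of j] by auto
  ultimately show ?thesis using assms(2,3) by auto
qed

section \<open>The polar row by row, and the entries that can be lowered\<close>

locale signed_pattern =
  fixes p d :: nat and t :: "nat \<Rightarrow> real" and eps :: "nat \<Rightarrow> nat \<Rightarrow> int"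
  assumes p_pos: "p \<ge> 1" and d_pos: "d \<ge> 1"
    and t_mono: "strict_mono_on {1..p} t"
    and eps_sign: "\<And>i j. i \<in> {1..p} \<Longrightarrow> j \<in> {1..d} \<Longrightarrow> eps i j \<in> {1, -1}"
begin

abbreviation polar :: "(nat \<Rightarrow> ereal) set" where
  "polar \<equiv> signed_cyclic_polar p d t eps"

lemma polar_vectors: "x \<in> polar \<Longrightarrow> x \<in> trop_vectors d"
  by (simp add: signed_cyclic_polar_def)

text \<open>Each column of the support contributes to exactly one of the two maxima, so the larger
  of them is the maximum of \<open>row_val\<close> over the support; the inequality says that the
  right-hand side reaches it.\<close>

lemma polar_row_iff:
  assumes x: "x \<in> trop_vectors d" and ne: "trop_supp x \<noteq> {}" and i: "i \<in> {1..p}"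
  shows "(MAX j\<in>{1..d}. C_minus t eps i j + x j) \<le> (MAX j\<in>{1..d}. C_plus t eps i j + x j) \<longleftrightarrow>
    (\<exists>j\<in>row_argmax t x i. eps i j = 1)" (is "?m \<le> ?M \<longleftrightarrow> _")
proof -
  have ni: "x j \<noteq> \<infinity>" for j using x by (simp add: trop_vectors_def)
  have S: "trop_supp x \<subseteq> {1..d}" by (rule trop_vectors_supp[OF x])
  have plus: "C_plus t eps i j + x j =
      (if eps i j = 1 \<and> j \<in> trop_supp x then ereal (row_val t x i j) else -\<infinity>)" for j
    using row_val_entry[OF x, of j t i] ni[of j] by (auto simp: C_plus_def trop_supp_def)
  have minus: "C_minus t eps i j + x j =
      (if eps i j = -1 \<and> j \<in> trop_supp x then ereal (row_val t x i j) else -\<infinity>)" for j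
    using row_val_entry[OF x, of j t i] ni[of j] by (auto simp: C_minus_def trop_supp_def)
  have fin: "finite {1..d}" "{1..d} \<noteq> {}" using d_pos by auto
  show ?thesis
  proof
    assume le: "?m \<le> ?M"
    obtain j where j: "j \<in> row_argmax t x i"
      using ex_row_argmax[OF finite_trop_supp[OF x] ne] by blast
    then have jS: "j \<in> trop_supp x" using row_argmax_supp by blast
    show "\<exists>j\<in>row_argmax t x i. eps i j = 1"
    proof (cases "eps i j = 1")
      case False
      then have "eps i j = -1" using eps_sign[OF i] jS S by blast
      then have "ereal (row_val t x i j) = C_minus t eps i j + x j" using minus jS by simp
      also have "\<dots> \<le> ?m" using jS S by (intro Max_ge) auto
      finally have 1: "ereal (row_val t x i j) \<le> ?M" using le by simp
      \<comment> \<open>A column attaining \<open>?M\<close> reaches the value of the maximizing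
        column \<open>j\<close>, so it is positive and maximizing itself.\<close>
      have "?M \<in> (\<lambda>j. C_plus t eps i j + x j) ` {1..d}" using fin by (intro Max_in) auto
      then obtain l where l: "?M = C_plus t eps i l + x l" by blast
      with 1 have "eps i l = 1 \<and> l \<in> trop_supp x \<and> row_val t x i j \<le> row_val t x i l"
        unfolding plus by (auto split: if_splits)
      then have "eps i l = 1" "l \<in> row_argmax t x i"
        using j by (auto simp: row_argmax_def intro: order_trans)
      then show ?thesis by blast
    qed (use j in blast)
  next
    assume "\<exists>j\<in>row_argmax t x i. eps i j = 1"
    then obtain j where j: "j \<in> row_argmax t x i" "eps i j = 1" by blast
    then have jS: "j \<in> trop_supp x" using row_argmax_supp by blast
    have "C_minus t eps i l + x l \<le> ereal (row_val t x i j)" for l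
      using row_argmaxD[OF j(1), of l] by (simp add: minus)
    then have "?m \<le> ereal (row_val t x i j)" using fin by (intro Max.boundedI) blast+
    also have "\<dots> = C_plus t eps i j + x j" using plus j jS by simp
    also have "\<dots> \<le> ?M" using jS S by (intro Max_ge) auto
    finally show "?m \<le> ?M" .
  qed
qed

text \<open>The support has to be nonempty: the zero vector lies in the polar but has no maximizing
  columns.\<close>

lemma polar_iff:
  assumes "trop_supp x \<noteq> {}"
  shows "x \<in> polar \<longleftrightarrow> x \<in> trop_vectors d \<and> (\<forall>i\<in>{1..p}. \<exists>j\<in>row_argmax t x i. eps i j = 1)"
  using polar_row_iff[OF _ assms] by (auto simp: signed_cyclic_polar_def)

text \<open>Row \<open>i\<close> blocks every decrease of entry \<open>j\<close>: afterwards no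
  positive column would be maximizing. A sole maximizing column survives a small decrease, hence the
  first conjunct.\<close>

definition tight :: "(nat \<Rightarrow> ereal) \<Rightarrow> nat \<Rightarrow> nat \<Rightarrow> bool" where
  "tight x i j \<longleftrightarrow> row_argmax t x i \<noteq> {j} \<and> {l \<in> row_argmax t x i. eps i l = 1} = {j}"

lemma tight_unique: "tight x i j \<Longrightarrow> tight x i l \<Longrightarrow> j = l"
  unfolding tight_def by blast

text \<open>Each of the finitely many rows tolerates all small decreases \<open>\<delta>\<close>;
  the filter \<open>at_right 0\<close> intersects these conditions.\<close>

lemma lower_coordinate:
  assumes x: "x \<in> polar" and j: "j \<in> trop_supp x" and nt: "\<And>i. i \<in> {1..p} \<Longrightarrow> \<not> tight x i j"
  shows "\<exists>v\<in>polar. v j < x j \<and> (\<forall>l. l \<noteq> j \<longrightarrow> v l = x l)"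
proof -
  have xv: "x \<in> trop_vectors d" by (rule polar_vectors[OF x])
  have ne: "trop_supp x \<noteq> {}" using j by auto
  define v where "v \<delta> = x(j := ereal (real_of_ereal (x j) - \<delta>))" for \<delta> :: real
  have supp: "trop_supp (v \<delta>) = trop_supp x" for \<delta>
    using j by (auto simp: v_def trop_supp_def)
  have val: "row_val t (v \<delta>) i l = row_val t x i l - (if l = j then \<delta> else 0)" for \<delta> i l
    by (simp add: v_def row_val_def)
  have "\<forall>\<^sub>F \<delta> in at_right 0. \<exists>l\<in>row_argmax t (v \<delta>) i. eps i l = 1" if i: "i \<in> {1..p}" for i
  proof -
    obtain l where l: "l \<in> row_argmax t x i" "eps i l = 1" using polar_iff[OF ne] x i by blast
    show ?thesis
    \<comment> \<open>Another positive maximizing column is unaffected by the decrease; otherwise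
      \<open>j\<close> is the only maximizing column, since row \<open>i\<close> is not tight for
      it.\<close>
    proof (cases "\<exists>l. l \<noteq> j \<and> l \<in> row_argmax t x i \<and> eps i l = 1")
      case True
      then obtain l where l: "l \<noteq> j" "l \<in> row_argmax t x i" "eps i l = 1" by blast
      then have "l \<in> row_argmax t (v \<delta>) i" if "\<delta> > 0" for \<delta>
        using that row_argmaxD[OF l(2)] by (fastforce simp: row_argmax_def supp val)
      then show ?thesis using l(3) by (auto simp: eventually_at_filter intro!: always_eventually)
    next
      case False
      with l have "l = j" by blast
      with l have lj: "l = j" "j \<in> row_argmax t x i" "eps i j = 1" by simp_all
      have "row_argmax t x i = {j}" using nt[OF i] False lj by (auto simp: tight_def)
      then have gap: "row_val t x i m < row_val t x i j" if "m \<in> trop_supp x - {j}" for m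
        using that row_argmaxD[OF lj(2)] unfolding row_argmax_def
        by (smt (verit, ccfv_SIG) DiffE mem_Collect_eq order_trans singleton_iff)
      \<comment> \<open>The decrease has to stay below the finitely many gaps to the other
        columns.\<close>
      have "\<forall>\<^sub>F \<delta> in at_right 0. \<forall>m\<in>trop_supp x - {j}. \<delta> < row_val t x i j - row_val t x i m"
        using finite_trop_supp[OF xv] gap
        by (intro eventually_ball_finite) (auto intro!: eventually_at_right_less eventually_at_rightI)
      then show ?thesis
      proof eventually_elim
        case (elim \<delta>)
        then have "row_val t (v \<delta>) i m \<le> row_val t (v \<delta>) i j" if "m \<in> trop_supp x" for m
          using that by (cases "m = j") (force simp: val)+
        then show ?case using lj j by (auto simp: row_argmax_def supp)
      qed
    qed
  qed
  then have "\<forall>\<^sub>F \<delta> in at_right 0. \<forall>i\<in>{1..p}. \<exists>l\<in>row_argmax t (v \<delta>) i. eps i l = 1"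
    by (intro eventually_ball_finite) auto
  then have "\<forall>\<^sub>F \<delta> in at_right (0::real). (\<forall>i\<in>{1..p}. \<exists>l\<in>row_argmax t (v \<delta>) i. eps i l = 1) \<and> 0 < \<delta>"
    by (intro eventually_conj eventually_at_right_less)
  then obtain \<delta> where \<delta>: "\<forall>i\<in>{1..p}. \<exists>l\<in>row_argmax t (v \<delta>) i. eps i l = 1" "0 < (\<delta>::real)"
    using eventually_happens'[OF trivial_limit_at_right_real] by blast
  have "v \<delta> \<in> trop_vectors d"
    using xv j trop_vectors_supp[OF xv] by (auto simp: trop_vectors_def v_def)
  then have "v \<delta> \<in> polar" using \<delta>(1) polar_iff[of "v \<delta>"] ne by (simp add: supp)
  moreover have "v \<delta> j < x j" using \<delta>(2) trop_vectors_entry[OF xv j]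
    by (cases "x j") (auto simp: v_def)
  moreover have "\<forall>l. l \<noteq> j \<longrightarrow> v \<delta> l = x l" by (simp add: v_def)
  ultimately show ?thesis by blast
qed

text \<open>
  Two untight coordinates \<open>j\<close> and \<open>l\<close> would exhibit the vector as the maximum of the two vectors
  obtained by lowering one of them.
\<close>

lemma extreme_tight:
  assumes x: "extreme_generator polar x"
    and j: "j \<in> trop_supp x" "\<And>i. i \<in> {1..p} \<Longrightarrow> \<not> tight x i j"
    and l: "l \<in> trop_supp x" "\<And>i. i \<in> {1..p} \<Longrightarrow> \<not> tight x i l"
  shows "j = l"
proof (rule ccontr)
  assume "j \<noteq> l"
  have xp: "x \<in> polar" using x by (simp add: extreme_generator_def)
  obtain v where v: "v \<in> polar" "v j < x j" "\<And>m. m \<noteq> j \<Longrightarrow> v m = x m"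
    using lower_coordinate[OF xp j] by blast
  obtain w where w: "w \<in> polar" "w l < x l" "\<And>m. m \<noteq> l \<Longrightarrow> w m = x m"
    using lower_coordinate[OF xp l] by blast
  have "x m = trop_add v w m" for m
    using v(2) v(3)[of m] w(2) w(3)[of m] \<open>j \<noteq> l\<close>
    by (cases "m = j"; cases "m = l") (auto simp: trop_add_def max_def)
  then have "x = v \<or> x = w" using x v(1) w(1) by (auto simp: extreme_generator_def fun_eq_iff)
  then show False using v(2) w(2) by auto
qed

text \<open>Adding the two maximality inequalities cancels the entries of \<open>x\<close> and
  leaves \<open>(j - j') * (t i' - t i) \<le> 0\<close>.\<close>

lemma row_argmax_mono:
  assumes "i \<in> {1..p}" "i' \<in> {1..p}" "i < i'" "j \<in> row_argmax t x i" "j' \<in> row_argmax t x i'"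
  shows "j \<le> j'"
proof (rule ccontr)
  assume "\<not> j \<le> j'"
  have "t i < t i'" using t_mono assms by (auto simp: strict_mono_on_def)
  moreover have "real j' < real j" using \<open>\<not> j \<le> j'\<close> by simp
  ultimately have "0 < (real j - real j') * (t i' - t i)" by (intro mult_pos_pos) auto
  moreover have "row_val t x i j' \<le> row_val t x i j" "row_val t x i' j \<le> row_val t x i' j'"
    using assms(4,5) by (auto simp: row_argmax_def)
  ultimately show False by (simp add: row_val_def algebra_simps)
qed

section \<open>Path data and the vectors they encode up to scaling\<close>

definition path_vector :: "(nat \<Rightarrow> ereal) \<Rightarrow> nat list \<Rightarrow> nat list \<Rightarrow> bool" where
  "path_vector x rs cs \<longleftrightarrow> x \<in> trop_vectors d \<and> path_data p d rs cs \<and> trop_supp x = set cs \<and>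
     (\<forall>q<length rs. row_val t x (rs ! q) (cs ! q) = row_val t x (rs ! q) (cs ! Suc q))"

lemma path_data_nth:
  assumes "path_data p d rs cs"
  shows "length cs = Suc (length rs)"
    "q < length rs \<Longrightarrow> rs ! q \<in> {1..p}"
    "q \<le> length rs \<Longrightarrow> cs ! q \<in> {1..d}"
    "q < q' \<Longrightarrow> q' < length rs \<Longrightarrow> rs ! q < rs ! q'"
    "q < q' \<Longrightarrow> q' \<le> length rs \<Longrightarrow> cs ! q < cs ! q'"
    "q \<le> q' \<Longrightarrow> q' < length rs \<Longrightarrow> rs ! q \<le> rs ! q'"
    "q \<le> length rs \<Longrightarrow> q' \<le> length rs \<Longrightarrow> cs ! q \<le> cs ! q' \<longleftrightarrow> q \<le> q'"
proof -
  show 1: "length cs = Suc (length rs)" using assms by (simp add: path_data_def)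
  show "q < length rs \<Longrightarrow> rs ! q \<in> {1..p}" using assms nth_mem by (fastforce simp: path_data_def)
  show "q \<le> length rs \<Longrightarrow> cs ! q \<in> {1..d}"
    using assms nth_mem[of q cs] 1 unfolding path_data_def by (metis le_imp_less_Suc subset_iff)
  show 2: "q < q' \<Longrightarrow> q' < length rs \<Longrightarrow> rs ! q < rs ! q'"
    using assms by (auto simp: path_data_def sorted_wrt_nth_less)
  show 3: "q < q' \<Longrightarrow> q' \<le> length rs \<Longrightarrow> cs ! q < cs ! q'" for q q'
    using assms 1 by (auto simp: path_data_def sorted_wrt_nth_less)
  show "q \<le> q' \<Longrightarrow> q' < length rs \<Longrightarrow> rs ! q \<le> rs ! q'"
    using 2 by (cases "q = q'") (auto intro: less_imp_le)
  show "q \<le> length rs \<Longrightarrow> q' \<le> length rs \<Longrightarrow> cs ! q \<le> cs ! q' \<longleftrightarrow> q \<le> q'"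
    using 3[of q q'] 3[of q' q] by (cases q q' rule: linorder_cases) auto
qed

text \<open>
  Along the columns of a path the values in a row \<open>i\<close> increase as long as \<open>rs ! q < i\<close> and decrease as
  soon as \<open>rs ! q > i\<close>.
\<close>

lemma path_vector_step:
  assumes "path_vector x rs cs" "q < length rs"
  shows "row_val t x i (cs ! Suc q) - row_val t x i (cs ! q) =
    (real (cs ! Suc q) - real (cs ! q)) * (t i - t (rs ! q))"
proof -
  have "row_val t x (rs ! q) (cs ! q) = row_val t x (rs ! q) (cs ! Suc q)"
    using assms by (simp add: path_vector_def)
  then show ?thesis by (simp add: row_val_def algebra_simps)
qed

text \<open>As \<open>rs\<close> increases, the values rise and then fall along \<open>cs\<close>,
  so comparison with the two neighbours decides maximality; \<open>r = 0\<close> and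
  \<open>r = length rs\<close> stand for a missing neighbour.\<close>

lemma path_vector_argmax:
  assumes P: "path_vector x rs cs" and i: "i \<in> {1..p}" and r: "r \<le> length rs"
  shows "cs ! r \<in> row_argmax t x i \<longleftrightarrow>
    (r = 0 \<or> rs ! (r - 1) \<le> i) \<and> (r = length rs \<or> i \<le> rs ! r)"
proof -
  have D: "path_data p d rs cs" and supp: "trop_supp x = set cs"
    using P by (auto simp: path_vector_def)
  note nth = path_data_nth[OF D]
  define f where "f q = row_val t x i (cs ! q)" for q
  have step: "f (Suc q) - f q = (real (cs ! Suc q) - real (cs ! q)) * (t i - t (rs ! q))"
    "real (cs ! Suc q) - real (cs ! q) > 0" if "q < length rs" for q
    using path_vector_step[OF P that] nth(5)[of q "Suc q"] that by (auto simp: f_def)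
  have t_le: "t a \<le> t b" if "a \<in> {1..p}" "b \<in> {1..p}" "a \<le> b" for a b
    using t_mono that by (simp add: strict_mono_on_leD)
  have t_less: "t a < t b" if "a \<in> {1..p}" "b \<in> {1..p}" "a < b" for a b
    using t_mono that by (simp add: strict_mono_onD)
  have up: "f q \<le> f (Suc q)" if "q < length rs" "rs ! q \<le> i" for q
    using step[OF that(1)] t_le[OF nth(2)[OF that(1)] i that(2)]
    by (metis diff_ge_0_iff_ge less_imp_le mult_nonneg_nonneg)
  have down: "f (Suc q) \<le> f q" if "q < length rs" "i \<le> rs ! q" for q
    using step[OF that(1)] t_le[OF i nth(2)[OF that(1)] that(2)]
    by (metis diff_le_0_iff_le less_imp_le mult_nonneg_nonpos)
  have up': "f q < f (Suc q)" if "q < length rs" "rs ! q < i" for q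
    using step[OF that(1)] t_less[OF nth(2)[OF that(1)] i that(2)]
    by (metis diff_gt_0_iff_gt mult_pos_pos)
  have down': "f (Suc q) < f q" if "q < length rs" "i < rs ! q" for q
    using step[OF that(1)] t_less[OF i nth(2)[OF that(1)] that(2)]
    by (metis diff_less_0_iff_less mult_pos_neg)
  have cols: "set cs = (!) cs ` {..length rs}"
    using nth(1) by (auto simp: set_conv_nth less_Suc_eq_le)
  have mem: "cs ! r \<in> row_argmax t x i \<longleftrightarrow> (\<forall>q\<le>length rs. f q \<le> f r)"
    using r by (auto simp: row_argmax_def supp f_def cols)
  show ?thesis unfolding mem
  proof
    assume max: "\<forall>q\<le>length rs. f q \<le> f r"
    have "rs ! (r - 1) \<le> i" if "r \<noteq> 0"
      using down'[of "r - 1"] max[rule_format, of "r - 1"] r that by force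
    moreover have "i \<le> rs ! r" if "r \<noteq> length rs"
      using up'[of r] max[rule_format, of "Suc r"] r that by force
    ultimately show "(r = 0 \<or> rs ! (r - 1) \<le> i) \<and> (r = length rs \<or> i \<le> rs ! r)" by blast
  next
    assume R: "(r = 0 \<or> rs ! (r - 1) \<le> i) \<and> (r = length rs \<or> i \<le> rs ! r)"
    show "\<forall>q\<le>length rs. f q \<le> f r"
    proof (intro allI impI)
      fix q assume q: "q \<le> length rs"
      show "f q \<le> f r"
      proof (cases "q \<le> r")
        case True
        then show ?thesis
        proof (induction rule: inc_induct)
          case (step q)
          \<comment> \<open>Monotonicity of \<open>rs\<close> passes the bound next to
            \<open>r\<close> on to all earlier steps, which therefore go up.\<close>
          have "rs ! q \<le> i" using R step(2) r nth(6)[of q "r - 1"] by fastforce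
          then show ?case using up[of q] step r by fastforce
        qed simp
      next
        case False
        then have "r \<le> q" by simp
        then show ?thesis using q
        proof (induction rule: dec_induct)
          case (step q)
          have "i \<le> rs ! q" using R step nth(6)[of r q] by fastforce
          then show ?case using down[of q] step by fastforce
        qed simp
      qed
    qed
  qed
qed

text \<open>Because \<open>rs\<close> is strictly increasing, no third column meets both bounds of
  \<open>path_vector_argmax\<close> in a tie row.\<close>

lemma path_vector_argmax_node:
  assumes P: "path_vector x rs cs" and q: "q < length rs"
  shows "row_argmax t x (rs ! q) = {cs ! q, cs ! Suc q}"
proof -
  have D: "path_data p d rs cs" and supp: "trop_supp x = set cs"
    using P by (auto simp: path_vector_def)
  note nth = path_data_nth[OF D]
  note am = path_vector_argmax[OF P nth(2)[OF q]]
  have "j \<in> {cs ! q, cs ! Suc q}" if j: "j \<in> row_argmax t x (rs ! q)" for j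
  proof -
    obtain r where r: "r \<le> length rs" "j = cs ! r"
      using j row_argmax_supp supp nth(1) by (metis in_set_conv_nth less_Suc_eq_le subset_iff)
    have "r = 0 \<or> rs ! (r - 1) \<le> rs ! q" "r = length rs \<or> rs ! q \<le> rs ! r"
      using am[OF r(1)] j r(2) by auto
    then have "r \<le> Suc q" "q \<le> r"
      using nth(4)[of q "r - 1"] nth(4)[of r q] q r by fastforce+
    then show ?thesis using r(2) by (metis insertI1 insertI2 le_SucE le_antisym)
  qed
  moreover have "cs ! q \<in> row_argmax t x (rs ! q)"
    using am[of q] q nth(6)[of "q - 1" q] by fastforce
  moreover have "Suc q = length rs \<or> rs ! q \<le> rs ! Suc q"
    using q nth(6)[of q "Suc q"] by linarith
  then have "cs ! Suc q \<in> row_argmax t x (rs ! q)" using am[of "Suc q"] q by simp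
  ultimately show ?thesis by blast
qed

text \<open>Covers the rows of a vertical segment away from the ties, where (C1) to (C3) ask for a
  positive sign: the strict bounds leave room for one column only.\<close>

lemma path_vector_argmax_between:
  assumes P: "path_vector x rs cs" and i: "i \<in> {1..p}" and r: "r \<le> length rs"
    and l: "r = 0 \<or> rs ! (r - 1) < i" and u: "r = length rs \<or> i < rs ! r"
  shows "row_argmax t x i = {cs ! r}"
proof -
  have D: "path_data p d rs cs" and supp: "trop_supp x = set cs"
    using P by (auto simp: path_vector_def)
  note nth = path_data_nth[OF D]
  note am = path_vector_argmax[OF P i]
  have "j = cs ! r" if j: "j \<in> row_argmax t x i" for j
  proof -
    obtain q where q: "q \<le> length rs" "j = cs ! q"
      using j row_argmax_supp supp nth(1) by (metis in_set_conv_nth less_Suc_eq_le subset_iff)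
    have "q = 0 \<or> rs ! (q - 1) \<le> i" "q = length rs \<or> i \<le> rs ! q"
      using am[OF q(1)] j q(2) by auto
    then have "q \<le> r" "r \<le> q"
      using nth(6)[of r "q - 1"] nth(6)[of q "r - 1"] l u r q(1) by fastforce+
    then show ?thesis using q by simp
  qed
  moreover have "cs ! r \<in> row_argmax t x i" using am[OF r] l u by auto
  ultimately show ?thesis by blast
qed

lemma row_position:
  assumes "path_data p d rs cs"
  obtains q where "q < length rs" "i = rs ! q"
  | r where "r \<le> length rs" "r = 0 \<or> rs ! (r - 1) < i" "r = length rs \<or> i < rs ! r"
proof -
  \<comment> \<open>The first tie row that is at least \<open>i\<close>, or the end of the list if
    there is none.\<close>
  define r where "r = (LEAST r. r = length rs \<or> i \<le> rs ! r)"
  have r: "r = length rs \<or> i \<le> rs ! r" unfolding r_def by (rule LeastI_ex) blast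
  have "r \<le> length rs" unfolding r_def by (rule Least_le) simp
  moreover have "r = 0 \<or> rs ! (r - 1) < i"
    using not_less_Least[of "r - 1" "\<lambda>r. r = length rs \<or> i \<le> rs ! r", folded r_def] by force
  ultimately show ?thesis using r that by (metis le_neq_implies_less)
qed

text \<open>Both lists can be read off from \<open>x\<close>: \<open>cs\<close> enumerates its
  support, \<open>rs\<close> the rows with exactly two maximizing columns.\<close>

lemma path_vector_eq:
  assumes P: "path_vector x rs cs" and P': "path_vector x rs' cs'"
  shows "rs = rs' \<and> cs = cs'"
proof
  have "set cs = set cs'" "sorted_wrt (<) cs" "sorted_wrt (<) cs'"
    using assms by (auto simp: path_vector_def path_data_def)
  then show "cs = cs'" using strict_sorted_equal by blast
  have "set rs = {i \<in> {1..p}. card (row_argmax t x i) = 2}" if P: "path_vector x rs cs" for rs cs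
  proof -
    have D: "path_data p d rs cs" using P by (simp add: path_vector_def)
    note nth = path_data_nth[OF D]
    have "card (row_argmax t x (rs ! q)) = 2" if "q < length rs" for q
      unfolding path_vector_argmax_node[OF P that] using nth(5)[of q "Suc q"] that by simp
    moreover have "i \<in> set rs" if "i \<in> {1..p}" "card (row_argmax t x i) = 2" for i
    proof (rule row_position[OF D, of i])
      fix r assume "r \<le> length rs" "r = 0 \<or> rs ! (r - 1) < i" "r = length rs \<or> i < rs ! r"
      from path_vector_argmax_between[OF P that(1) this] that(2) show ?thesis by simp
    qed auto
    ultimately show ?thesis using nth(2) by (fastforce simp: in_set_conv_nth)
  qed
  from this[OF P] this[OF P'] have "set rs = set rs'" by simp
  moreover have "sorted_wrt (<) rs" "sorted_wrt (<) rs'"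
    using assms by (auto simp: path_vector_def path_data_def)
  ultimately show "rs = rs'" using strict_sorted_equal by blast
qed

lemma ex_path_vector:
  assumes D: "path_data p d rs cs"
  shows "\<exists>x. path_vector x rs cs"
proof -
  note nth = path_data_nth[OF D]
  \<comment> \<open>The tie in row \<open>rs ! q\<close> forces the entry to drop by
    \<open>g q\<close> from \<open>cs ! q\<close> to \<open>cs ! Suc q\<close>. Entries are thus
    negated partial sums, starting with 0 at \<open>cs ! 0\<close>.\<close>
  define g where "g q = (real (cs ! Suc q) - real (cs ! q)) * t (rs ! q)" for q
  define x where "x j = (if j \<in> set cs
    then ereal (- (\<Sum>q | q < length rs \<and> cs ! Suc q \<le> j. g q)) else -\<infinity>)" for j
  have "x \<in> trop_vectors d" using D by (auto simp: trop_vectors_def x_def path_data_def)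
  moreover have "trop_supp x = set cs" by (auto simp: trop_supp_def x_def)
  moreover have "row_val t x (rs ! q) (cs ! q) = row_val t x (rs ! q) (cs ! Suc q)"
    if q: "q < length rs" for q
  proof -
    have set: "{q. q < length rs \<and> cs ! Suc q \<le> cs ! r} = {..<r}" if "r \<le> length rs" for r
      using that nth(7) by auto
    have "x (cs ! r) = ereal (- (\<Sum>q<r. g q))" if "r \<le> length rs" for r
      using that nth(1) unfolding x_def set[OF that] by simp
    then show ?thesis using q by (simp add: row_val_def g_def algebra_simps)
  qed
  ultimately show ?thesis using D by (auto simp: path_vector_def)
qed

lemma path_vector_scale:
  assumes "path_vector x rs cs"
  shows "path_vector (trop_scale (ereal l) x) rs cs"
proof -
  have x: "x \<in> trop_vectors d" using assms by (simp add: path_vector_def)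
  have supp: "trop_supp (trop_scale (ereal l) x) = trop_supp x"
    by (auto simp: trop_supp_def trop_scale_def)
  have "trop_scale (ereal l) x \<in> trop_vectors d"
    using x by (auto simp: trop_vectors_def trop_scale_def)
  moreover have val: "row_val t (trop_scale (ereal l) x) i j = l + row_val t x i j"
    if "j \<in> trop_supp x" for i j
  proof -
    have "trop_scale (ereal l) x j = ereal (l + real_of_ereal (x j))"
      unfolding trop_scale_def by (subst trop_vectors_entry[OF x that]) simp
    then show ?thesis by (simp add: row_val_def)
  qed
  ultimately show ?thesis using assms supp path_data_nth(1)[of rs cs]
    by (auto simp: path_vector_def val)
qed

text \<open>The ties fix the differences of consecutive entries, so only the entry at
  \<open>cs ! 0\<close> is free.\<close>

lemma path_vector_unique:
  assumes P: "path_vector x rs cs" and P': "path_vector y rs cs"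
  shows "\<exists>l. y = trop_scale (ereal l) x"
proof -
  have D: "path_data p d rs cs" and x: "x \<in> trop_vectors d" and y: "y \<in> trop_vectors d"
    and supp: "trop_supp x = set cs" "trop_supp y = set cs"
    using assms by (auto simp: path_vector_def)
  note nth = path_data_nth[OF D]
  define l where "l = real_of_ereal (y (cs ! 0)) - real_of_ereal (x (cs ! 0))"
  have eq: "real_of_ereal (y (cs ! r)) = l + real_of_ereal (x (cs ! r))" if "r \<le> length rs" for r
    using that
  proof (induction r)
    case (Suc r)
    then have "r < length rs" by simp
    \<comment> \<open>Row 0 is an arbitrary choice: the right-hand side of
      \<open>path_vector_step\<close> is the same for \<open>x\<close> and \<open>y\<close>.\<close>
    from path_vector_step[OF P this, of 0] path_vector_step[OF P' this, of 0] Suc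
    show ?case by (simp add: row_val_def)
  qed (simp add: l_def)
  have "y j = trop_scale (ereal l) x j" for j
  proof (cases "j \<in> set cs")
    case True
    then obtain r where r: "r \<le> length rs" "j = cs ! r"
      by (metis in_set_conv_nth less_Suc_eq_le nth(1))
    show ?thesis
      unfolding trop_scale_def using eq[OF r(1)] True r(2) supp
      by (metis trop_vectors_entry[OF x] trop_vectors_entry[OF y] plus_ereal.simps(1))
  next
    case False
    then have "x j = -\<infinity>" "y j = -\<infinity>" using supp by (auto simp: trop_supp_def)
    then show ?thesis by (simp add: trop_scale_def)
  qed
  then show ?thesis by blast
qed

text \<open>Merges (C1) to (C3) into one condition whose cases match those of
  \<open>row_position\<close>.\<close>

lemma allowed_iff:
  assumes D: "path_data p d rs cs"
  shows "allowed p eps rs cs \<longleftrightarrow>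
    (\<forall>i\<in>{1..p}. \<forall>r\<le>length rs. (r = 0 \<or> rs ! (r - 1) < i) \<longrightarrow> (r = length rs \<or> i < rs ! r) \<longrightarrow>
      eps i (cs ! r) = 1) \<and>
    (\<forall>q<length rs. (eps (rs ! q) (cs ! q), eps (rs ! q) (cs ! Suc q)) \<in> {(1, -1), (-1, 1)})"
    (is "_ \<longleftrightarrow> ?A \<and> ?B")
proof -
  note nth = path_data_nth[OF D]
  have "?A" if a: "allowed p eps rs cs"
  proof (intro ballI allI impI)
    fix i r assume *: "i \<in> {1..p}" "r \<le> length rs" "r = 0 \<or> rs ! (r - 1) < i" "r = length rs \<or> i < rs ! r"
    \<comment> \<open>In this order: the single segment, the initial, the final and the intermediate
      ones.\<close>
    consider "length rs = 0" | "length rs \<ge> 1" "r = 0" | "length rs \<ge> 1" "r = length rs"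
      | "1 \<le> r" "r < length rs" using *(2) by linarith
    then show "eps i (cs ! r) = 1"
      using a * unfolding allowed_def Let_def by cases auto
  qed
  moreover have "allowed p eps rs cs" if A: ?A and B: ?B
  proof -
    have A': "eps i (cs ! r) = 1" if "1 \<le> i" "i \<le> p" "r \<le> length rs"
      "r = 0 \<or> rs ! (r - 1) < i" "r = length rs \<or> i < rs ! r" for i r
      using A that by auto
    show ?thesis
      unfolding allowed_def Let_def
    proof (intro conjI impI allI)
      fix i assume "1 \<le> length rs" "1 \<le> i \<and> i < rs ! 0"
      then show "eps i (cs ! 0) = 1" using A'[of i 0] nth(2)[of 0] by fastforce
    next
      fix i assume "1 \<le> length rs" "rs ! (length rs - 1) < i \<and> i \<le> p"
      then show "eps i (cs ! length rs) = 1" using A'[of i "length rs"] by auto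
    next
      fix i assume "length rs = 0" "1 \<le> i \<and> i \<le> p"
      then show "eps i (cs ! 0) = 1" using A'[of i 0] by auto
    next
      fix r i assume "1 \<le> r \<and> r < length rs" "rs ! (r - 1) < i \<and> i < rs ! r"
      then show "eps i (cs ! r) = 1" using A'[of i r] nth(2)[of r] by fastforce
    qed (use B in auto)
  qed
  moreover have "?B" if "allowed p eps rs cs" using that by (auto simp: allowed_def Let_def)
  ultimately show ?thesis by blast
qed

section \<open>From tropically allowed paths to extreme generators\<close>

lemma allowed_polar:
  assumes P: "path_vector x rs cs" and a: "allowed p eps rs cs"
  shows "x \<in> polar"
proof -
  have D: "path_data p d rs cs" using P by (simp add: path_vector_def)
  note nth = path_data_nth[OF D] and a' = a[unfolded allowed_iff[OF D]]
  have "trop_supp x \<noteq> {}" using P nth(1) by (auto simp: path_vector_def)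
  moreover have "\<exists>j\<in>row_argmax t x i. eps i j = 1" if i: "i \<in> {1..p}" for i
  proof (rule row_position[OF D, of i])
    fix q assume "q < length rs" "i = rs ! q"
    then show ?thesis using a' path_vector_argmax_node[OF P, of q] by auto
  next
    fix r assume r: "r \<le> length rs" "r = 0 \<or> rs ! (r - 1) < i" "r = length rs \<or> i < rs ! r"
    show ?thesis using path_vector_argmax_between[OF P i r] a' r i by auto
  qed
  ultimately show ?thesis using P by (simp add: polar_iff path_vector_def)
qed

text \<open>As \<open>v\<close> lies below \<open>x\<close> and agrees with it at the maximizing
  column \<open>j\<close>, both have the same maximum in row \<open>i\<close>. A positive column
  where \<open>v\<close> attains it is also maximizing for \<open>x\<close>, so it is
  \<open>l\<close>, and there \<open>v\<close> cannot be smaller.\<close>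

lemma polar_propagate:
  assumes x: "x \<in> trop_vectors d" and v: "v \<in> polar" and le: "\<And>l. v l \<le> x l" and i: "i \<in> {1..p}"
    and j: "j \<in> row_argmax t x i" "v j = x j"
    and l: "\<And>m. m \<in> row_argmax t x i \<Longrightarrow> eps i m = 1 \<Longrightarrow> m = l"
  shows "v l = x l"
proof -
  have vv: "v \<in> trop_vectors d" by (rule polar_vectors[OF v])
  have jx: "j \<in> trop_supp x" using j(1) row_argmax_supp by blast
  then have jv: "j \<in> trop_supp v" using j(2) by (simp add: trop_supp_def)
  then obtain m where m: "m \<in> row_argmax t v i" "eps i m = 1" using polar_iff[of v] v i by blast
  then have mv: "m \<in> trop_supp v" using row_argmax_supp by blast
  then have mx: "m \<in> trop_supp x" using le[of m] by (auto simp: trop_supp_def)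
  have "real_of_ereal (v m) \<le> real_of_ereal (x m)"
    using le[of m] trop_vectors_entry[OF vv mv] trop_vectors_entry[OF x mx] by (metis ereal_less_eq(3))
  then have vx: "row_val t v i m \<le> row_val t x i m" by (simp add: row_val_def)
  moreover have "row_val t x i j \<le> row_val t v i m"
    using row_argmaxD[OF m(1) jv] j(2) by (simp add: row_val_def)
  moreover have "row_val t x i k \<le> row_val t x i j" if "k \<in> trop_supp x" for k
    using row_argmaxD[OF j(1) that] .
  ultimately have "m \<in> row_argmax t x i" using mx by (force simp: row_argmax_def)
  then have ml: "m = l" using l m(2) by blast
  have "row_val t x i m \<le> row_val t x i j" using row_argmaxD[OF j(1) mx] .
  then have "row_val t v i m = row_val t x i m"
    using vx \<open>row_val t x i j \<le> row_val t v i m\<close> by simp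
  then have "real_of_ereal (v m) = real_of_ereal (x m)" by (simp add: row_val_def)
  then show ?thesis using trop_vectors_entry[OF vv mv] trop_vectors_entry[OF x mx] ml by metis
qed

text \<open>
  The column \<open>cs ! s\<close> at which the horizontal segments switch from signs \<open>(1, -1)\<close> to signs \<open>(-1, 1)\<close>
  determines all the entries: in each tie the positive column is the one further away from \<open>cs ! s\<close>.
\<close>

lemma tropically_allowed_extreme:
  assumes P: "path_vector x rs cs" and a: "tropically_allowed p eps rs cs"
  shows "extreme_generator polar x"
proof -
  have D: "path_data p d rs cs" and x: "x \<in> trop_vectors d" and supp: "trop_supp x = set cs"
    using P by (auto simp: path_vector_def)
  note nth = path_data_nth[OF D]
  have al: "allowed p eps rs cs" using a by (simp add: tropically_allowed_def)
  note a' = al[unfolded allowed_iff[OF D]]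
  have signs: "(eps (rs ! q) (cs ! q), eps (rs ! q) (cs ! Suc q)) \<in> {(1, -1), (-1, 1)}"
    if "q < length rs" for q using a' that by blast
  \<comment> \<open>If no tie has signs \<open>(-1, 1)\<close>, then \<open>s = length rs\<close>
    and \<open>cs ! s\<close> is the last column.\<close>
  define s where "s = (LEAST q. q = length rs \<or> eps (rs ! q) (cs ! q) = -1)"
  have s: "s = length rs \<or> eps (rs ! s) (cs ! s) = -1" unfolding s_def by (rule LeastI_ex) blast
  have sk: "s \<le> length rs" unfolding s_def by (rule Least_le) simp
  have before: "eps (rs ! q) (cs ! q) = 1 \<and> eps (rs ! q) (cs ! Suc q) = -1" if "q < s" for q
  proof -
    have "eps (rs ! q) (cs ! q) \<noteq> -1"
      using not_less_Least[OF that[unfolded s_def]] by blast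
    then show ?thesis using signs[of q] that sk by auto
  qed
  have after: "eps (rs ! q) (cs ! q) = -1 \<and> eps (rs ! q) (cs ! Suc q) = 1"
    if "s \<le> q" "q < length rs" for q
  proof -
    have "eps (rs ! s) (cs ! s) = -1" using s that by auto
    then have "(eps (rs ! s) (cs ! s), eps (rs ! s) (cs ! (s + 1))) = (-1, 1)"
      using signs[of s] that by auto
    \<comment> \<open>(C5) carries the signs of tie \<open>s\<close> on to all later ties.\<close>
    then have "(eps (rs ! q) (cs ! q), eps (rs ! q) (cs ! (q + 1))) = (-1, 1)"
      using a that unfolding tropically_allowed_def by (meson order.strict_trans1)
    then show ?thesis by simp
  qed
  \<comment> \<open>Equality spreads from \<open>cs ! s\<close> in both directions, each tie passing
    it from its negative to its positive column.\<close>
  have key: "v = x" if v: "v \<in> polar" "\<And>l. v l \<le> x l" "v (cs ! s) = x (cs ! s)" for v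
  proof -
    have "v (cs ! r) = x (cs ! r)" if r: "r \<le> length rs" for r
    proof (cases "r \<le> s")
      case True
      then show ?thesis
      proof (induction rule: inc_induct)
        case (step q)
        then have q: "q < length rs" using sk by simp
        show ?case
          by (rule polar_propagate[OF x v(1,2) nth(2)[OF q], of "cs ! Suc q"])
            (use step before[of q] path_vector_argmax_node[OF P q] in auto)
      qed (rule v)
    next
      case False
      then have "s \<le> r" by simp
      then show ?thesis using r
      proof (induction rule: dec_induct)
        case (step q)
        then have q: "q < length rs" by simp
        show ?case
          by (rule polar_propagate[OF x v(1,2) nth(2)[OF q], of "cs ! q"])
            (use step after[of q] path_vector_argmax_node[OF P q] in auto)
      qed (rule v)
    qed
    then have on: "v j = x j" if "j \<in> set cs" for j
      using that nth(1) by (metis in_set_conv_nth less_Suc_eq_le)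
    have "v j = x j" for j
    proof (cases "j \<in> set cs")
      case False
      then have "x j = -\<infinity>" using supp by (auto simp: trop_supp_def)
      then show ?thesis using v(2)[of j] by simp
    qed (rule on)
    then show ?thesis by blast
  qed
  have "x = v \<or> x = w" if "v \<in> polar" "w \<in> polar" "x = trop_add v w" for v w
  proof -
    have max: "x l = max (v l) (w l)" for l using that by (metis trop_add_def)
    \<comment> \<open>One of the two summands attains the entry at \<open>cs ! s\<close>; by
      \<open>key\<close> it equals \<open>x\<close>.\<close>
    have "v l \<le> x l" "w l \<le> x l" "v (cs ! s) = x (cs ! s) \<or> w (cs ! s) = x (cs ! s)" for l
      unfolding max by (auto simp: max_def)
    then show ?thesis using key that by metis
  qed
  moreover have "x \<noteq> (\<lambda>_. -\<infinity>)"
    using supp nth(1) trop_supp_nonempty[of x] by (metis length_0_conv nat.distinct(1) set_empty)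
  ultimately show ?thesis using allowed_polar[OF P al] unfolding extreme_generator_def by blast
qed

section \<open>From extreme generators to tropically allowed paths\<close>

text \<open>
  Rows with a tie have increasing smallest (and largest) maximizing columns, so there are fewer of
  them than columns in the support. As all columns in the support but one own a tie, both counts are
  sharp, which makes the ties link the columns of the support in a chain.
\<close>

lemma extreme_path:
  assumes x: "extreme_generator polar x"
  shows "\<exists>rs cs. path_vector x rs cs \<and> tropically_allowed p eps rs cs"
proof -
  have xp: "x \<in> polar" and nz: "trop_supp x \<noteq> {}"
    using x by (auto simp: extreme_generator_def trop_supp_nonempty)
  have xv: "x \<in> trop_vectors d" by (rule polar_vectors[OF xp])
  define S where "S = trop_supp x"
  define A where "A = row_argmax t x"
  have S: "finite S" "S \<noteq> {}" "S \<subseteq> {1..d}"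
    using finite_trop_supp[OF xv] nz trop_vectors_supp[OF xv] by (auto simp: S_def)
  have AS: "A i \<subseteq> S" for i using row_argmax_supp by (auto simp: A_def S_def)
  have Ane: "A i \<noteq> {}" for i using ex_row_argmax[of x] S by (auto simp: A_def S_def)
  have Afin: "finite (A i)" for i using AS S finite_subset by blast
  define B where "B = {i \<in> {1..p}. Min (A i) < Max (A i)}"
  have Bfin: "finite B" by (simp add: B_def)
  have minmax: "Max (A i) \<le> Min (A i')" if "i \<in> B" "i' \<in> B" "i < i'" for i i'
    using that row_argmax_mono[of i i' "Max (A i)" x "Min (A i')"]
      Max_in[OF Afin Ane, of i] Min_in[OF Afin Ane, of i']
    by (simp add: B_def A_def)
  have min_less: "Min (A i) < Min (A i')" "Max (A i) < Max (A i')"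
    if "i \<in> B" "i' \<in> B" "i < i'" for i i'
    using minmax[OF that] that by (auto simp: B_def)
  have injm: "inj_on (\<lambda>i. Min (A i)) B" "inj_on (\<lambda>i. Max (A i)) B"
    using min_less by (auto intro!: linorder_inj_onI' less_imp_neq)
  \<comment> \<open>The smallest column of a tie is never the last one of the support; with
    injectivity this bounds the number of ties by \<open>card S - 1\<close>. The next fact is the
    mirror image.\<close>
  have imm: "(\<lambda>i. Min (A i)) ` B \<subseteq> S - {Max S}"
  proof (clarsimp, intro conjI)
    fix i assume i: "i \<in> B"
    show "Min (A i) \<in> S" using Min_in[OF Afin Ane] AS by blast
    have "Max (A i) \<le> Max S" using AS Ane S by (intro Max_mono)
    then show "Min (A i) \<noteq> Max S" using i by (auto simp: B_def)
  qed
  have imM: "(\<lambda>i. Max (A i)) ` B \<subseteq> S - {Min S}"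
  proof (clarsimp, intro conjI)
    fix i assume i: "i \<in> B"
    show "Max (A i) \<in> S" using Max_in[OF Afin Ane] AS by blast
    have "Min S \<le> Min (A i)" using AS Ane S by (intro Min_antimono)
    then show "Max (A i) \<noteq> Min S" using i by (auto simp: B_def)
  qed
  define T where "T = {j \<in> S. \<exists>i\<in>{1..p}. tight x i j}"
  have TS: "T \<subseteq> S" by (auto simp: T_def)
  \<comment> \<open>Chooses for each tight column a row that blocks it; by
    \<open>tight_unique\<close> no row is chosen twice.\<close>
  define \<rho> where "\<rho> j = (SOME i. i \<in> {1..p} \<and> tight x i j)" for j
  have \<rho>: "\<rho> j \<in> {1..p}" "tight x (\<rho> j) j" if "j \<in> T" for j
  proof -
    have "\<exists>i. i \<in> {1..p} \<and> tight x i j" using that by (auto simp: T_def)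
    from someI_ex[OF this] show "\<rho> j \<in> {1..p}" "tight x (\<rho> j) j" unfolding \<rho>_def by blast+
  qed
  have inj\<rho>: "inj_on \<rho> T"
    using \<rho>(2) tight_unique by (metis inj_onI)
  have im\<rho>: "\<rho> ` T \<subseteq> B"
  proof clarify
    fix j assume j: "j \<in> T"
    have "j \<in> A (\<rho> j)" "A (\<rho> j) \<noteq> {j}" using \<rho>(2)[OF j] by (auto simp: tight_def A_def)
    then obtain l where l: "l \<in> A (\<rho> j)" "l \<noteq> j" by blast
    have "Min (A (\<rho> j)) \<le> l" "Min (A (\<rho> j)) \<le> j" "l \<le> Max (A (\<rho> j))" "j \<le> Max (A (\<rho> j))"
      using l \<open>j \<in> A (\<rho> j)\<close> Afin by (auto intro: Min_le Max_ge)
    then show "\<rho> j \<in> B" using \<rho>(1)[OF j] l(2) by (auto simp: B_def)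
  qed
  have "card (S - T) \<le> 1"
    using extreme_tight[OF x] by (intro card_le_Suc0_iff_eq[THEN iffD2, folded One_nat_def])
      (auto simp: S_def[symmetric] T_def S(1))
  moreover have "card S = card T + card (S - T)"
    using card_Diff_subset[of T S] card_mono[OF S(1) TS] finite_subset[OF TS S(1)] TS by simp
  moreover have "card T \<le> card B" by (rule card_inj_on_le[OF inj\<rho> im\<rho> Bfin])
  moreover have "card B \<le> card (S - {Max S})"
    by (rule card_inj_on_le[OF injm(1) imm]) (use S in simp)
  moreover have "card (S - {Max S}) = card S - 1" "card (S - {Min S}) = card S - 1" "card S \<ge> 1"
    using S by (auto simp: Suc_le_eq card_gt_0_iff)
  \<comment> \<open>\<open>card S - 1 \<le> card T \<le> card B \<le> card S - 1\<close>, so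
    equality holds throughout and the three injections are onto.\<close>
  ultimately have cards: "card B = card T" "card B = card (S - {Max S})"
    "card B = card (S - {Min S})" "card S = Suc (card B)" by linarith+
  have im\<rho>': "\<rho> ` T = B"
    using im\<rho> cards(1) card_image[OF inj\<rho>] Bfin by (metis card_subset_eq)
  have imm': "(\<lambda>i. Min (A i)) ` B = S - {Max S}" "(\<lambda>i. Max (A i)) ` B = S - {Min S}"
    using imm imM cards(2,3) card_image[OF injm(1)] card_image[OF injm(2)] S(1)
    by (metis card_subset_eq finite_Diff)+
  define rs where "rs = sorted_list_of_set B"
  define cs where "cs = sorted_list_of_set S"
  have rs: "sorted_wrt (<) rs" "set rs = B" "length rs = card B" using Bfin by (auto simp: rs_def)
  have cs: "sorted_wrt (<) cs" "set cs = S" "length cs = Suc (length rs)"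
    using S cards(4) rs by (auto simp: cs_def)
  have D: "path_data p d rs cs"
    using rs cs S by (auto simp: path_data_def B_def)
  note nth = path_data_nth[OF D]
  have MinS: "Min S = cs ! 0" and MaxS: "Max S = cs ! length rs"
  proof -
    have "cs ! 0 \<le> j \<and> j \<le> cs ! length rs" if "j \<in> S" for j
    proof -
      obtain r where "r \<le> length rs" "j = cs ! r"
        using \<open>j \<in> S\<close> cs by (metis in_set_conv_nth less_Suc_eq_le)
      then show ?thesis
        using nth(5)[of 0 r] nth(5)[of r "length rs"] by (cases "r = 0"; cases "r = length rs") auto
    qed
    moreover have "cs ! 0 \<in> S" "cs ! length rs \<in> S" using cs by (metis nth_mem lessI zero_less_Suc)+
    ultimately show "Min S = cs ! 0" "Max S = cs ! length rs"
      using S by (auto intro!: Min_eqI Max_eqI)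
  qed
  have "cs \<noteq> []" using cs(3) by auto
  \<comment> \<open>In order, the smallest columns of the ties run through all of \<open>cs\<close>
    but the last entry, the largest through all but the first; so tie \<open>q\<close> joins
    \<open>cs ! q\<close> to \<open>cs ! Suc q\<close>.\<close>
  define cs1 where "cs1 = butlast cs"
  define cs2 where "cs2 = tl cs"
  have "cs ! 0 = hd cs" "cs ! length rs = last cs"
    using \<open>cs \<noteq> []\<close> cs(3) by (simp_all add: hd_conv_nth last_conv_nth)
  then have csE: "cs = cs1 @ [Max S]" "cs = Min S # cs2"
    using \<open>cs \<noteq> []\<close> unfolding MinS MaxS cs1_def cs2_def by simp_all
  have "map (\<lambda>i. Min (A i)) rs = cs1"
  proof (rule strict_sorted_equal)
    show "sorted_wrt (<) (map (\<lambda>i. Min (A i)) rs)"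
      using rs min_less(1) by (auto simp: sorted_wrt_map intro: sorted_wrt_mono_rel[of rs "(<)"])
    show "sorted_wrt (<) cs1" "set (map (\<lambda>i. Min (A i)) rs) = set cs1"
      using cs(1,2) rs(2) imm'(1) unfolding csE(1) by (auto simp: sorted_wrt_append)
  qed
  moreover have "map (\<lambda>i. Max (A i)) rs = cs2"
  proof (rule strict_sorted_equal)
    show "sorted_wrt (<) (map (\<lambda>i. Max (A i)) rs)"
      using rs min_less(2) by (auto simp: sorted_wrt_map intro: sorted_wrt_mono_rel[of rs "(<)"])
    show "sorted_wrt (<) cs2" "set (map (\<lambda>i. Max (A i)) rs) = set cs2"
      using cs(1,2) rs(2) imm'(2) unfolding csE(2) by auto
  qed
  ultimately have ends: "Min (A (rs ! q)) = cs ! q" "Max (A (rs ! q)) = cs ! Suc q"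
    if "q < length rs" for q
    using that cs(3) unfolding cs1_def cs2_def
    by (metis nth_map nth_butlast length_map, metis nth_map nth_tl length_map)
  have P: "path_vector x rs cs"
    unfolding path_vector_def
  proof (intro conjI allI impI)
    fix q assume q: "q < length rs"
    have "cs ! q \<in> A (rs ! q)" "cs ! Suc q \<in> A (rs ! q)"
      using Min_in[OF Afin Ane] Max_in[OF Afin Ane] ends[OF q] by metis+
    then show "row_val t x (rs ! q) (cs ! q) = row_val t x (rs ! q) (cs ! Suc q)"
      by (auto simp: A_def row_argmax_def intro: antisym)
  qed (use D xv cs in \<open>auto simp: S_def\<close>)
  note node = path_vector_argmax_node[OF P]
  \<comment> \<open>Since \<open>\<rho>\<close> is onto \<open>B\<close>, every tie is the row
    chosen for its only positive column.\<close>
  have tie: "\<exists>j\<in>T. rs ! q = \<rho> j \<and> {l \<in> {cs ! q, cs ! Suc q}. eps (rs ! q) l = 1} = {j}"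
    if q: "q < length rs" for q
  proof -
    have "rs ! q \<in> \<rho> ` T" using nth_mem[OF q] rs(2) im\<rho>' by simp
    then obtain j where j: "j \<in> T" "rs ! q = \<rho> j" by blast
    then show ?thesis using \<rho>(2)[OF j(1)] node[OF q] by (auto simp: tight_def)
  qed
  have signs: "(eps (rs ! q) (cs ! q), eps (rs ! q) (cs ! Suc q)) \<in> {(1, -1), (-1, 1)}"
    if q: "q < length rs" for q
  proof -
    have "eps (rs ! q) (cs ! q) \<in> {1, -1}" "eps (rs ! q) (cs ! Suc q) \<in> {1, -1}"
      using eps_sign[OF nth(2)[OF q] nth(3)] q by simp_all
    moreover have "cs ! q < cs ! Suc q" using nth(5) q by simp
    moreover obtain j where j: "{l \<in> {cs ! q, cs ! Suc q}. eps (rs ! q) l = 1} = {j}"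
      using tie[OF q] by blast
    ultimately show ?thesis using unique_sign[of "cs ! q" "cs ! Suc q" "eps (rs ! q)" j] by simp
  qed
  \<comment> \<open>Signs \<open>(-1, 1)\<close> followed by \<open>(1, -1)\<close> would make
    \<open>cs ! Suc q\<close> the positive column of two ties, although \<open>\<rho>\<close>
    assigns it a single row.\<close>
  have next_sign: "eps (rs ! Suc q) (cs ! Suc q) = -1"
    if q: "Suc q < length rs" and "eps (rs ! q) (cs ! q) = -1" for q
  proof (rule ccontr)
    assume "eps (rs ! Suc q) (cs ! Suc q) \<noteq> -1"
    then have 1: "eps (rs ! Suc q) (cs ! Suc q) = 1" using signs[OF q] by auto
    have 2: "eps (rs ! q) (cs ! Suc q) = 1" using signs[of q] that by auto
    obtain j where j: "rs ! q = \<rho> j" "{l \<in> {cs ! q, cs ! Suc q}. eps (rs ! q) l = 1} = {j}"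
      using tie[OF Suc_lessD[OF q]] by blast
    obtain l where l: "rs ! Suc q = \<rho> l"
      "{m \<in> {cs ! Suc q, cs ! Suc (Suc q)}. eps (rs ! Suc q) m = 1} = {l}"
      using tie[OF q] by blast
    have "cs ! Suc q \<in> {j}" unfolding j(2)[symmetric] using 2 by simp
    moreover have "cs ! Suc q \<in> {l}" unfolding l(2)[symmetric] using 1 by simp
    ultimately have "rs ! q = rs ! Suc q" using j(1) l(1) by simp
    then show False using nth(4)[of q "Suc q"] q by simp
  qed
  have "allowed p eps rs cs"
    unfolding allowed_iff[OF D]
  proof (intro conjI ballI allI impI)
    fix i r assume i: "i \<in> {1..p}"
      and r: "r \<le> length rs" "r = 0 \<or> rs ! (r - 1) < i" "r = length rs \<or> i < rs ! r"
    have "\<exists>j\<in>row_argmax t x i. eps i j = 1" using polar_iff[OF nz] xp i by blast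
    then show "eps i (cs ! r) = 1" using path_vector_argmax_between[OF P i r] by simp
  qed (use signs in blast)
  moreover have "eps (rs ! s) (cs ! s) = -1 \<and> eps (rs ! s) (cs ! Suc s) = 1"
    if "r \<le> s" "s < length rs" "eps (rs ! r) (cs ! r) = -1" for r s
  proof -
    have "eps (rs ! s) (cs ! s) = -1"
      using that by (induction rule: dec_induct) (use next_sign in auto)
    then show ?thesis using signs[OF that(2)] by auto
  qed
  ultimately have "tropically_allowed p eps rs cs"
    unfolding tropically_allowed_def by simp blast
  with P show ?thesis by blast
qed

section \<open>The bijection between rays and paths\<close>

lemma bij_betw_rays_paths:
  "\<exists>f. bij_betw f (extreme_rays polar) (tropically_allowed_paths p d eps)"
proof -
  \<comment> \<open>The path data mediate: they are in bijection with the rays through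
    \<open>vec\<close> and with the paths through \<open>lattice_path\<close>.\<close>
  define D where "D = {(rs, cs). path_data p d rs cs \<and> tropically_allowed p eps rs cs}"
  define vec where "vec = (\<lambda>(rs, cs). SOME x. path_vector x rs cs)"
  have vec: "path_vector (vec (rs, cs)) rs cs" if "(rs, cs) \<in> D" for rs cs
    using someI_ex[OF ex_path_vector[of rs cs]] that by (simp add: vec_def D_def)
  have "bij_betw (\<lambda>z. trop_ray (vec z)) D (extreme_rays polar)"
  proof (rule bij_betw_imageI)
    show "inj_on (\<lambda>z. trop_ray (vec z)) D"
    proof (rule inj_onI, clarify)
      fix rs cs rs' cs' assume z: "(rs, cs) \<in> D" and z': "(rs', cs') \<in> D"
        and eq: "trop_ray (vec (rs, cs)) = trop_ray (vec (rs', cs'))"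
      note P = vec[OF z] and P' = vec[OF z']
      have ne: "vec (rs, cs) \<noteq> (\<lambda>_. -\<infinity>)"
        using P path_data_nth(1)[of rs cs] trop_supp_nonempty[of "vec (rs, cs)"]
        by (auto simp: path_vector_def)
      have "trop_scale 0 (vec (rs, cs)) \<in> trop_ray (vec (rs, cs))"
        by (auto simp: trop_ray_def)
      then have "vec (rs, cs) \<in> trop_ray (vec (rs', cs'))" by (simp add: eq trop_scale_def)
      then obtain l where l: "l \<noteq> \<infinity>" "vec (rs, cs) = trop_scale l (vec (rs', cs'))"
        by (auto simp: trop_ray_def)
      have "vec (rs', cs') j \<noteq> \<infinity>" for j using P' by (simp add: path_vector_def trop_vectors_def)
      \<comment> \<open>A ray also contains the zero vector, its multiple by minus infinity; this
        scalar has to be excluded before \<open>path_vector_scale\<close> applies.\<close>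
      with l ne have "l \<noteq> -\<infinity>" by (auto simp: trop_scale_def fun_eq_iff)
      with l(1) obtain m where "l = ereal m" by (cases l) auto
      with l(2) have "path_vector (vec (rs, cs)) rs' cs'" using path_vector_scale[OF P'] by simp
      then show "rs = rs' \<and> cs = cs'" by (rule path_vector_eq[OF P])
    qed
    show "(\<lambda>z. trop_ray (vec z)) ` D = extreme_rays polar"
    proof (intro equalityI subsetI)
      fix R assume "R \<in> (\<lambda>z. trop_ray (vec z)) ` D"
      then obtain rs cs where z: "(rs, cs) \<in> D" "R = trop_ray (vec (rs, cs))" by auto
      then have "extreme_generator polar (vec (rs, cs))"
        using tropically_allowed_extreme[OF vec] by (auto simp: D_def)
      then show "R \<in> extreme_rays polar" using z by (auto simp: extreme_rays_def)
    next
      fix R assume "R \<in> extreme_rays polar"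
      then obtain x where x: "extreme_generator polar x" "R = trop_ray x"
        by (auto simp: extreme_rays_def)
      obtain rs cs where P: "path_vector x rs cs" "tropically_allowed p eps rs cs"
        using extreme_path[OF x(1)] by blast
      then have z: "(rs, cs) \<in> D" by (simp add: D_def path_vector_def)
      obtain l where "vec (rs, cs) = trop_scale (ereal l) x"
        using path_vector_unique[OF P(1) vec[OF z]] by blast
      then have "R = trop_ray (vec (rs, cs))" using x(2) by (simp add: trop_ray_scale)
      with z show "R \<in> (\<lambda>z. trop_ray (vec z)) ` D" by blast
    qed
  qed
  moreover have "bij_betw (\<lambda>(rs, cs). lattice_path p rs cs) D (tropically_allowed_paths p d eps)"
  proof (rule bij_betw_imageI)
    show "inj_on (\<lambda>(rs, cs). lattice_path p rs cs) D"
      using lattice_path_inject[OF p_pos] by (auto simp: inj_on_def D_def)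
  qed (auto simp: tropically_allowed_paths_def D_def)
  ultimately show ?thesis using bij_betw_inv_into bij_betw_trans by blast
qed

end

theorem theorem2:
  fixes p d :: nat and t :: "nat \<Rightarrow> real" and eps :: "nat \<Rightarrow> nat \<Rightarrow> int"
  assumes "p \<ge> 1" and "d \<ge> 1"
    and "strict_mono_on {1..p} t"
    and "\<forall>i\<in>{1..p}. \<forall>j\<in>{1..d}. eps i j \<in> {1, -1}"
  shows "\<exists>f. bij_betw f (extreme_rays (signed_cyclic_polar p d t eps))
                        (tropically_allowed_paths p d eps)"
proof -
  interpret signed_pattern p d t eps by standard (use assms in auto)
  show ?thesis by (rule bij_betw_rays_paths)
qed

end
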